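(* Let $p,q,r\in\mathbb{R}$ with $r>0$, let $h(t)=t^3+pt^2+qt+r$, and let $\Delta(h)=p^2q^2+18pqr-27r^2-4p^3r-4q^3$. Then: (1) $h(t)>0$ for all real $t\ge 0$ if and only if at least one of the following holds: (A) $p\ge 0$ and $q\ge 0$; (B) $\Delta(h)<0$. (2) If $\Delta(h)=0$ and either $p<0$ or $q<0$, then $h(t)\ge 0$ for all $t\ge 0$, and the number $\alpha=\dfrac{9r-pq}{2p^2-6q}$ satisfies $\alpha>0$ and $h(\alpha)=0$. (3) In all other cases (that is, when neither (A) nor (B) holds and the hypothesis of (2) does not hold), there is a $t>0$ such that $h(t)<0$.
   Context: All polynomials have real coefficients. $\Delta(h)$ is the discriminant of the cubic $h$. *)

theory Defs
  imports "HOL-Analysis.Analysis" "Subresultants.Resultant_Prelim"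
begin

text \<open>With the sign convention below, the discriminant of a polynomial with leading coefficient
  \<open>a\<close> and roots \<open>x\<^sub>1, \<dots>, x\<^sub>n\<close> (in a splitting field, in characteristic zero) is
  \<open>a\<close> to the power \<open>2 n - 2\<close> times the product of the \<open>(x\<^sub>i - x\<^sub>j)\<^sup>2\<close> over \<open>i < j\<close>.\<close>

definition discriminant :: "'a :: field_char_0 poly \<Rightarrow> 'a" where
  "discriminant f =
     (-1) ^ (degree f * (degree f - 1) div 2) * resultant f (pderiv f) / lead_coeff f"

end

theory Submission
  imports Defs "HOL-Real_Asymp.Real_Asymp"
begin

text \<open>Since \<open>h\<close> is positive at \<open>0\<close>, it has a negative root \<open>-c\<close>, so \<open>h = (t + c) (t\<^sup>2 + b t + d)\<close>
  with \<open>c, d > 0\<close>, and its discriminant is that of the quadratic factor times \<open>(c\<^sup>2 - b c + d)\<^sup>2\<close>.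
  If \<open>b \<ge> 0\<close>, then all coefficients of \<open>h\<close> are nonnegative. If \<open>b < 0\<close>, the square is nonzero,
  so the sign of the discriminant is that of \<open>b\<^sup>2 - 4 d\<close>, which decides the sign of \<open>h\<close> at the
  vertex \<open>-b/2 > 0\<close> of the quadratic factor; if the discriminant vanishes, this is the double root \<open>\<alpha>\<close>.\<close>

text \<open>Defined by recursion because a conditional would pile up, unevaluated, under the binders of the
  iterated Laplace expansion.\<close>

fun skip :: "nat \<Rightarrow> nat \<Rightarrow> nat" where
  "skip 0 k = Suc k"
| "skip (Suc j) 0 = 0"
| "skip (Suc j) (Suc k) = Suc (skip j k)"

lemma skip_eq: "skip j k = (if k < j then k else Suc k)"
  by (induction j k rule: skip.induct) auto

text \<open>Laplace expansion along the top row. Each minor is again a \<open>mat\<close> of an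
  explicit function, so the equation can rewrite its own output down to dimension 0.\<close>

lemma det_mat_Suc:
  "Determinant.det (mat (Suc n) (Suc n) f) =
     (\<Sum>j<Suc n. f (0, j) * (- 1) ^ j *
        Determinant.det (mat n n (\<lambda>(i, k). f (Suc i, skip j k))))"
  for f :: "nat \<times> nat \<Rightarrow> 'a :: comm_ring_1"
proof -
  have "mat_delete (mat (Suc n) (Suc n) f) 0 j = mat n n (\<lambda>(i, k). f (Suc i, skip j k))" for j
    by (rule eq_matI) (auto simp: mat_delete_def skip_eq)
  then show ?thesis
    by (subst laplace_expansion_row[where i = 0 and n = "Suc n"])
      (auto simp: cofactor_def mult.assoc intro!: sum.cong)
qed

text \<open>Direct expansion of the 5 by 5 Sylvester determinant, whose sign is reversed by the
  factor \<open>(-1) ^ 3\<close> in \<open>discriminant\<close>.\<close>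

lemma discriminant_monic_cubic:
  fixes p q r :: "'a :: field_char_0"
  shows "discriminant [:r, q, p, 1:] =
    p\<^sup>2 * q\<^sup>2 + 18 * p * q * r - 27 * r\<^sup>2 - 4 * p ^ 3 * r - 4 * q ^ 3"
proof -
  \<comment> \<open>Indices stay in successor form, which is what \<open>det_mat_Suc\<close> and
    \<open>skip\<close> match and produce.\<close>
  let ?n1 = "Suc 0" let ?n2 = "Suc ?n1" let ?n3 = "Suc ?n2" let ?n4 = "Suc ?n3"
  let ?h = "[:r, q, p, 1:]" and ?h' = "[:q, 2 * p, 3:]"
  define f :: "nat \<times> nat \<Rightarrow> 'a" where "f = (\<lambda>(i, j).
     if i < 2 then if i \<le> j \<and> j - i \<le> 3 then coeff ?h (3 + i - j) else 0
     else if i - 2 \<le> j \<and> j \<le> i then coeff ?h' (i - j) else 0)"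
  have "pderiv ?h = ?h'"
    by (simp add: pderiv_pCons)
  moreover have deg: "degree ?h = 3" "degree ?h' = 2"
    by simp_all
  ultimately have "resultant ?h (pderiv ?h) = Determinant.det (mat (3 + 2) (3 + 2) f)"
    by (simp only: resultant_def sylvester_mat_def sylvester_mat_sub_def f_def)
  also have "3 + 2 = Suc ?n4"
    by simp
  also have "Determinant.det (mat (Suc ?n4) (Suc ?n4) f) =
      - (p\<^sup>2 * q\<^sup>2 + 18 * p * q * r - 27 * r\<^sup>2 - 4 * p ^ 3 * r - 4 * q ^ 3)"
  proof -
    have entries:
      "f (0, 0) = 1" "f (0, ?n1) = p" "f (0, ?n2) = q" "f (0, ?n3) = r" "f (0, ?n4) = 0"
      "f (?n1, 0) = 0" "f (?n1, ?n1) = 1" "f (?n1, ?n2) = p" "f (?n1, ?n3) = q" "f (?n1, ?n4) = r"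
      "f (?n2, 0) = 3" "f (?n2, ?n1) = 2 * p" "f (?n2, ?n2) = q" "f (?n2, ?n3) = 0" "f (?n2, ?n4) = 0"
      "f (?n3, 0) = 0" "f (?n3, ?n1) = 3" "f (?n3, ?n2) = 2 * p" "f (?n3, ?n3) = q" "f (?n3, ?n4) = 0"
      "f (?n4, 0) = 0" "f (?n4, ?n1) = 0" "f (?n4, ?n2) = 3" "f (?n4, ?n3) = 2 * p" "f (?n4, ?n4) = q"
      by (simp_all add: f_def numeral_eq_Suc)
    show ?thesis
      apply (simp only: det_mat_Suc sum.lessThan_Suc lessThan_0 sum.empty split skip.simps entries)
      apply (simp only: mult_zero_left mult_zero_right add_0_left add_0_right power_0
          mult_1_left mult_1_right)
      apply (simp only: det_dim_zero mat_carrier mult_1_left mult_1_right power_Suc power_0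
          mult_minus_left mult_minus_right minus_minus)
      apply (simp add: algebra_simps power2_eq_square power3_eq_cube)
      done
  qed
  finally show ?thesis
    using deg(1) by (simp add: discriminant_def)
qed

text \<open>The squared factor is the value of \<open>t^2 + b t + d\<close> at \<open>-c\<close>, up
  to sign the resultant of the two factors.\<close>

lemma discriminant_linear_times_quadratic:
  fixes b c d :: "'a :: field_char_0"
  shows "discriminant [:c * d, b * c + d, b + c, 1:] = (b\<^sup>2 - 4 * d) * (c\<^sup>2 - b * c + d)\<^sup>2"
  unfolding discriminant_monic_cubic
  by (simp add: algebra_simps power2_eq_square power3_eq_cube)

text \<open>A root \<open>-c < 0\<close> exists by the intermediate value theorem. Division by
  \<open>t + c\<close> leaves remainder 0, which is \<open>r = c * d\<close>; hence
  \<open>d > 0\<close>.\<close>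

lemma monic_cubic_factorization:
  fixes p q r :: real
  assumes "r > 0"
  obtains b c d where "c > 0" "d > 0" "p = b + c" "q = b * c + d" "r = c * d"
proof -
  let ?h = "[:r, q, p, 1:]"
  have "filterlim (\<lambda>t::real. t ^ 3 + p * t\<^sup>2 + q * t + r) at_bot at_bot"
    by real_asymp
  then have "\<forall>\<^sub>F t in at_bot. t ^ 3 + p * t\<^sup>2 + q * t + r < 0 \<and> t < 0"
    by (intro eventually_conj) (auto simp: filterlim_at_bot_dense)
  then obtain t where t: "t ^ 3 + p * t\<^sup>2 + q * t + r < 0" "t < 0"
    using eventually_happens'[OF trivial_limit_at_bot_linorder] by blast
  have "poly ?h t < 0"
    using t by (simp add: algebra_simps power2_eq_square power3_eq_cube)
  then obtain x where x: "x < 0" "poly ?h x = 0"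
    using poly_IVT_pos[OF t(2), of ?h] assms by auto
  let ?c = "- x" and ?b = "p + x"
  let ?d = "q - ?b * ?c"
  have "r = ?c * ?d"
    using x(2) by (simp add: algebra_simps)
  moreover from this have "?d > 0"
    using assms x(1) by (metis neg_0_less_iff_less zero_less_mult_pos)
  ultimately show thesis
    using that[of ?c ?d ?b] x(1) by simp
qed

theorem theorem3p2:
  fixes p q r :: real
  assumes "r > 0"
  defines "h \<equiv> [:r, q, p, 1:]"
  shows
    "discriminant h = p\<^sup>2 * q\<^sup>2 + 18 * p * q * r - 27 * r\<^sup>2 - 4 * p ^ 3 * r - 4 * q ^ 3
     \<and> ((\<forall>t\<ge>0. poly h t > 0) \<longleftrightarrow> (p \<ge> 0 \<and> q \<ge> 0) \<or> discriminant h < 0)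
     \<and> (discriminant h = 0 \<and> (p < 0 \<or> q < 0) \<longrightarrow>
          (\<forall>t\<ge>0. poly h t \<ge> 0) \<and>
          (let \<alpha> = (9 * r - p * q) / (2 * p\<^sup>2 - 6 * q) in \<alpha> > 0 \<and> poly h \<alpha> = 0))
     \<and> (\<not> (p \<ge> 0 \<and> q \<ge> 0) \<and> \<not> discriminant h < 0 \<and>
          \<not> (discriminant h = 0 \<and> (p < 0 \<or> q < 0)) \<longrightarrow>
          (\<exists>t>0. poly h t < 0))"
proof -
  from assms(1) obtain b c d where c: "c > 0" and d: "d > 0"
    and p: "p = b + c" and q: "q = b * c + d" and r: "r = c * d"
    by (rule monic_cubic_factorization)
  have h: "poly h t = (t + c) * ((t + b / 2)\<^sup>2 - (b\<^sup>2 - 4 * d) / 4)" for t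
    unfolding h_def p q r by (simp add: field_simps power2_eq_square)
  have disc: "discriminant h = (b\<^sup>2 - 4 * d) * (c\<^sup>2 - b * c + d)\<^sup>2"
    unfolding h_def p q r by (rule discriminant_linear_times_quadratic)
  have b_nonneg: "p \<ge> 0 \<and> q \<ge> 0" if "b \<ge> 0"
    using that c d unfolding p q by simp
  have nonzero: "c\<^sup>2 - b * c + d > 0" if "b < 0"
    using that c d by (smt (verit) mult_neg_pos zero_less_power)
  have sgn_iff: "discriminant h < 0 \<longleftrightarrow> b\<^sup>2 < 4 * d" "discriminant h = 0 \<longleftrightarrow> b\<^sup>2 = 4 * d"
    if "b < 0"
    using nonzero[OF that] unfolding disc by (auto simp: mult_less_0_iff)
  have pos_A: "poly h t > 0" if "p \<ge> 0" "q \<ge> 0" "t \<ge> 0" for t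
    using that assms(1) unfolding h_def by (simp add: add_pos_nonneg)
  \<comment> \<open>At the vertex, \<open>h\<close> equals
    \<open>(c - b/2) * (4 * d - b^2) / 4\<close>, with positive first factor.\<close>
  have neg_value: "- b / 2 > 0 \<and> poly h (- b / 2) \<le> 0 \<and> (b\<^sup>2 > 4 * d \<longrightarrow> poly h (- b / 2) < 0)"
    if "b < 0" "b\<^sup>2 \<ge> 4 * d"
    using that c unfolding h
    by (auto simp: mult_le_0_iff mult_less_0_iff)
  have pos_B: "poly h t > 0" if "discriminant h < 0" "t \<ge> 0" for t
  proof -
    have "b\<^sup>2 - 4 * d < 0"
      using that(1) unfolding disc by (auto simp: mult_less_0_iff)
    then have "(t + b / 2)\<^sup>2 - (b\<^sup>2 - 4 * d) / 4 > 0"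
      by (smt (verit) divide_neg_pos zero_le_power2)
    then show ?thesis
      using that(2) c unfolding h by simp
  qed
  have "(\<forall>t\<ge>0. poly h t > 0) \<longleftrightarrow> (p \<ge> 0 \<and> q \<ge> 0) \<or> discriminant h < 0"
    \<comment> \<open>If (A) and (B) both fail, then \<open>b < 0\<close> and
      \<open>b^2 \<ge> 4 * d\<close>, so \<open>-b/2\<close> refutes positivity.\<close>
    using pos_A pos_B b_nonneg sgn_iff neg_value by (smt (verit))
  moreover have "(\<forall>t\<ge>0. poly h t \<ge> 0) \<and>
      (let \<alpha> = (9 * r - p * q) / (2 * p\<^sup>2 - 6 * q) in \<alpha> > 0 \<and> poly h \<alpha> = 0)"
    if "discriminant h = 0" "p < 0 \<or> q < 0"
  proof -
    have b: "b < 0"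
      using that(2) b_nonneg by linarith
    then have d_eq: "d = b\<^sup>2 / 4"
      using sgn_iff(2) that(1) by simp
    \<comment> \<open>The common factor \<open>(c - b/2)^2\<close> is nonzero as
      \<open>b < 0 < c\<close>; cancelling it turns \<open>\<alpha>\<close> into the double root
      \<open>-b/2\<close>.\<close>
    have "2 * p\<^sup>2 - 6 * q = 2 * (c - b / 2)\<^sup>2" "9 * r - p * q = - b * (c - b / 2)\<^sup>2"
      unfolding p q r d_eq by (simp_all add: field_simps power2_eq_square)
    then have "(9 * r - p * q) / (2 * p\<^sup>2 - 6 * q) = - b / 2"
      using b c by simp
    moreover have "poly h t = (t + c) * (t + b / 2)\<^sup>2" for t
      unfolding h d_eq by simp
    ultimately show ?thesis
      using b c by (simp add: Let_def)
  qed
  moreover have "\<exists>t>0. poly h t < 0"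
    if "\<not> (p \<ge> 0 \<and> q \<ge> 0)" "\<not> discriminant h < 0"
      "\<not> (discriminant h = 0 \<and> (p < 0 \<or> q < 0))"
    \<comment> \<open>Only a positive discriminant remains, so \<open>b^2 > 4 * d\<close> and the
      value at \<open>-b/2\<close> is strictly negative.\<close>
    using that b_nonneg sgn_iff neg_value by (smt (verit))
  ultimately show ?thesis
    using discriminant_monic_cubic[of r q p] unfolding h_def by blast
qed

end
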